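(* Let $g:\mathbb{Z}^n \to \mathbb{R}\cup\{+\infty\}$ be a semi-strictly quasi L$^{\natural}$-convex function with $\arg\min g \neq \emptyset$, and let $p^\circ\in\mathrm{dom}\, g$. Then the algorithm SteepestDescent, applied to $g$ with initial vector $p^\circ$, outputs a minimizer of $g$ and terminates exactly in $\mu(p^\circ)+1$ iterations.
   Context: Notation: $n$ is a positive integer, $N=\{1,\dots,n\}$; for $X\subseteq N$, $e_X\in\{0,1\}^n$ is the characteristic vector of $X$ ($e_X(i)=1$ if $i\in X$, and $e_X(i)=0$ otherwise); $\mathbf{1}=(1,\dots,1)$; $p\wedge q$ and $p\vee q$ denote the component-wise minimum and maximum of $p,q\in\mathbb{Z}^n$; $\mathrm{dom}\, g=\{p\in\mathbb{Z}^n\mid g(p)<+\infty\}$; $\arg\min g$ is the set of minimizers of $g$ (vectors in $\mathrm{dom}\, g$ attaining the minimum of $g$). Definition. A function $g:\mathbb{Z}^n\to\mathbb{R}\cup\{+\infty\}$ is semi-strictly quasi L$^{\natural}$-convex if for every $p,q\in\mathrm{dom}\, g$ and every nonnegative integer $\lambda$, both (I) and (II) hold: (I) at least one of the following holds: (a) $g(p)>g((p-\lambda\mathbf{1})\vee q)$; (b) $g(q)>g(p\wedge(q+\lambda\mathbf{1}))$; (c) $g(p)=g((p-\lambda\mathbf{1})\vee q)$ and $g(q)=g(p\wedge(q+\lambda\mathbf{1}))$. (II) at least one of the following holds: (a) $g(q)>g((p-\lambda\mathbf{1})\vee q)$; (b) $g(p)>g(p\wedge(q+\lambda\mathbf{1}))$;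 (c) $g(q)=g((p-\lambda\mathbf{1})\vee q)$ and $g(p)=g(p\wedge(q+\lambda\mathbf{1}))$. For $q\in\mathbb{Z}^n$, $\|q\|_\infty^+=\max_{i\in N}\max(0,q(i))$ and $\|q\|_\infty^-=\max_{i\in N}\max(0,-q(i))$. For $p\in\mathbb{Z}^n$, $$\mu(p)=\min\{\|p^*-p\|_\infty^+ + \|p^*-p\|_\infty^- \mid p^*\in\arg\min g\}.$$ Algorithm SteepestDescent with initial vector $p^\circ$: Step 0: Set $p:=p^\circ$. Step 1: Find $\sigma\in\{+1,-1\}$ and $X\subseteq N$ that minimize $g(p+\sigma e_X)$ (over all such pairs; ties are broken arbitrarily). Step 2: If $g(p+\sigma e_X)=g(p)$, then output $p$ and stop. Step 3: Set $p:=p+\sigma e_X$ and go to Step 1. The number of iterations is the number of times Step 1 is executed (including the last execution, after which the algorithm stops in Step 2). *)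

theory Defs
  imports "HOL-Analysis.Analysis"
begin

text \<open>
  The ground set \<open>N\<close> is the type \<open>'n\<close>, so that \<open>\<int>\<^sup>n\<close> is \<^typ>\<open>int ^ 'n\<close>.
  Functions into \<open>\<real> \<union> {+\<infinity>}\<close> are functions into \<^typ>\<open>ereal\<close> that avoid \<open>- \<infinity>\<close>.
\<close>

definition char_vec :: "'n::finite set \<Rightarrow> int ^ 'n" where
  "char_vec X = (\<chi> i. if i \<in> X then 1 else 0)"

text \<open>The library orders vectors component-wise but provides \<^const>\<open>inf\<close> and \<^const>\<open>sup\<close>
  only over ordered Euclidean spaces, which excludes integer components.\<close>

definition vec_min :: "int ^ 'n::finite \<Rightarrow> int ^ 'n \<Rightarrow> int ^ 'n" (infixl "\<sqinter>\<^sub>v" 60) where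
  "p \<sqinter>\<^sub>v q = (\<chi> i. min (p $ i) (q $ i))"

definition vec_max :: "int ^ 'n::finite \<Rightarrow> int ^ 'n \<Rightarrow> int ^ 'n" (infixl "\<squnion>\<^sub>v" 60) where
  "p \<squnion>\<^sub>v q = (\<chi> i. max (p $ i) (q $ i))"

definition eff_dom :: "(int ^ 'n::finite \<Rightarrow> ereal) \<Rightarrow> (int ^ 'n) set" where
  "eff_dom g = {p. g p < \<infinity>}"

definition argmin :: "(int ^ 'n::finite \<Rightarrow> ereal) \<Rightarrow> (int ^ 'n) set" where
  "argmin g = {p \<in> eff_dom g. \<forall>q. g p \<le> g q}"

text \<open>\<^term>\<open>vec (int l)\<close> is the constant vector \<open>\<lambda>\<one>\<close>.\<close>

definition semistrictly_quasi_Lnat_convex :: "(int ^ 'n::finite \<Rightarrow> ereal) \<Rightarrow> bool" where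
  "semistrictly_quasi_Lnat_convex g \<longleftrightarrow>
    (\<forall>p \<in> eff_dom g. \<forall>q \<in> eff_dom g. \<forall>l::nat.
      (g p > g ((p - vec (int l)) \<squnion>\<^sub>v q) \<or>
       g q > g (p \<sqinter>\<^sub>v (q + vec (int l))) \<or>
       (g p = g ((p - vec (int l)) \<squnion>\<^sub>v q) \<and> g q = g (p \<sqinter>\<^sub>v (q + vec (int l))))) \<and>
      (g q > g ((p - vec (int l)) \<squnion>\<^sub>v q) \<or>
       g p > g (p \<sqinter>\<^sub>v (q + vec (int l))) \<or>
       (g q = g ((p - vec (int l)) \<squnion>\<^sub>v q) \<and> g p = g (p \<sqinter>\<^sub>v (q + vec (int l))))))"

definition linf_pos :: "int ^ 'n::finite \<Rightarrow> int" where
  "linf_pos q = Max (range (\<lambda>i. max 0 (q $ i)))"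

definition linf_neg :: "int ^ 'n::finite \<Rightarrow> int" where
  "linf_neg q = Max (range (\<lambda>i. max 0 (- (q $ i))))"

text \<open>Taken in \<^typ>\<open>nat\<close>, where the minimum of a nonempty (possibly infinite) set exists;
  if \<^term>\<open>argmin g\<close> is empty, the value is unspecified.\<close>

definition mu :: "(int ^ 'n::finite \<Rightarrow> ereal) \<Rightarrow> int ^ 'n \<Rightarrow> nat" where
  "mu g p = (LEAST d. \<exists>r \<in> argmin g. int d = linf_pos (r - p) + linf_neg (r - p))"

text \<open>
  \<open>Search p\<close>: the algorithm is about to execute Step 1 with current vector \<open>p\<close>;
  \<open>Output p\<close>: it has stopped with output \<open>p\<close>.
  A transition performs Step 1 once, followed by Step 2 and, if applicable, Step 3. It is a
  relation because ties in Step 1 are broken arbitrarily.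
\<close>

datatype 'n config = Search "int ^ 'n" | Output "int ^ 'n"

definition steepest :: "(int ^ 'n::finite \<Rightarrow> ereal) \<Rightarrow> int ^ 'n \<Rightarrow> int \<Rightarrow> 'n set \<Rightarrow> bool" where
  "steepest g p \<sigma> X \<longleftrightarrow>
    is_arg_min (\<lambda>(\<tau>, Y). g (p + \<tau> *s char_vec Y)) (\<lambda>(\<tau>, Y). \<tau> \<in> {1, -1}) (\<sigma>, X)"

inductive sd_step :: "(int ^ 'n::finite \<Rightarrow> ereal) \<Rightarrow> 'n config \<Rightarrow> 'n config \<Rightarrow> bool"
  for g :: "int ^ 'n::finite \<Rightarrow> ereal" where
  stop: "steepest g p \<sigma> X \<Longrightarrow> g (p + \<sigma> *s char_vec X) = g p \<Longrightarrow>
    sd_step g (Search p) (Output p)"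
| move: "steepest g p \<sigma> X \<Longrightarrow> g (p + \<sigma> *s char_vec X) \<noteq> g p \<Longrightarrow>
    sd_step g (Search p) (Search (p + \<sigma> *s char_vec X))"

text \<open>An execution is an infinite sequence of configurations: it either follows transitions
  forever or stays constant once an output has been produced.\<close>

definition sd_execution ::
  "(int ^ 'n::finite \<Rightarrow> ereal) \<Rightarrow> int ^ 'n \<Rightarrow> (nat \<Rightarrow> 'n config) \<Rightarrow> bool" where
  "sd_execution g p0 c \<longleftrightarrow> c 0 = Search p0 \<and>
    (\<forall>k. case c k of Search p \<Rightarrow> sd_step g (c k) (c (Suc k)) | Output p \<Rightarrow> c (Suc k) = c k)"

text \<open>The number of iterations is the number of transitions, the stopping one included.\<close>

definition terminates_with :: "(nat \<Rightarrow> 'n::finite config) \<Rightarrow> nat \<Rightarrow> int ^ 'n \<Rightarrow> bool" where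
  "terminates_with c k r \<longleftrightarrow> (\<forall>j<k. \<exists>p. c j = Search p) \<and> c k = Output r"

text \<open>Step 1 can always be carried out, so statements about all executions are not vacuous.\<close>

lemma ex_steepest: "\<exists>\<sigma> X. steepest g p \<sigma> X"
proof -
  let ?S = "{y :: int \<times> 'a set. case y of (\<tau>, Y) \<Rightarrow> \<tau> \<in> {1, -1}}"
  have "?S = {1, -1} \<times> UNIV" by auto
  then have "finite ?S" "?S \<noteq> {}" by (auto simp del: finite_Collect_disjI)
  from ex_is_arg_min_if_finite[OF this, of "\<lambda>(\<tau>, Y). g (p + \<tau> *s char_vec Y)"]
  show ?thesis unfolding steepest_def by auto
qed

lemma ex_sd_execution: "\<exists>c. sd_execution g p0 c"
proof -
  let ?R = "\<lambda>x y. case x of Search p \<Rightarrow> sd_step g x y | Output p \<Rightarrow> y = x"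
  have "\<exists>y. ?R x y" for x
  proof (cases x)
    case (Search p)
    obtain \<sigma> X where "steepest g p \<sigma> X" using ex_steepest by blast
    then have "\<exists>y. sd_step g (Search p) y"
      using sd_step.stop sd_step.move by metis
    then show ?thesis using Search by simp
  qed simp
  then have "\<forall>x. \<exists>y. ?R x y" by blast
  then obtain F where F: "\<forall>x. ?R x (F x)" by (rule choice[THEN exE])
  have "sd_execution g p0 (\<lambda>k. (F ^^ k) (Search p0))"
    unfolding sd_execution_def
  proof (intro conjI allI)
    fix k
    show "case (F ^^ k) (Search p0) of
        Search p \<Rightarrow> sd_step g ((F ^^ k) (Search p0)) ((F ^^ Suc k) (Search p0))
      | Output p \<Rightarrow> (F ^^ Suc k) (Search p0) = (F ^^ k) (Search p0)"
      using F[rule_format, of "(F ^^ k) (Search p0)"] unfolding funpow.simps o_apply .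
  qed simp
  then show ?thesis by blast
qed

end

theory Submission
  imports Defs
begin

text \<open>
  A minimizer \<open>r\<close> lies at distance at most \<open>k\<close> from \<open>p\<close>, in the norm underlying \<open>\<mu>\<close>, exactly when
  \<open>- b \<le> r - p \<le> a\<close> for some \<open>a, b \<ge> 0\<close> with \<open>a + b = k\<close>. The heart of the matter is
  that one step of the algorithm decreases \<open>\<mu>\<close> by exactly one as long as \<open>\<mu>\<close> is positive.

  The decrease cannot exceed one, since a step moves \<open>p\<close> by a vector of norm at most one. For
  the other bound, let \<open>x = p + e\<^sub>X\<close> be a best neighbour of \<open>p\<close> and \<open>r\<close> a minimizer in the box
  \<open>- b \<le> r - p \<le> a\<close>. If an exchange between \<open>x\<close> and \<open>r\<close> turns \<open>x\<close> into another
  neighbour of \<open>p\<close>, then the value of \<open>g\<close> cannot fall on the side of \<open>x\<close>, nor can it on the side of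
  \<open>r\<close>, so semi-strict quasi-convexity leaves only the case of two equalities: the partner of
  \<open>x\<close>'s image is again a minimizer. Suitable shifts \<open>\<lambda>\<close> move \<open>r\<close> in this way to a
  minimizer in a box around \<open>x\<close> with \<open>a + b\<close> smaller by one. Steps in the direction \<open>- e\<^sub>X\<close> reduce to
  this by the reflection \<open>p \<mapsto> - p\<close>.

  This argument uses only that \<open>x\<close> is a best neighbour, not that it improves on \<open>p\<close>. If the best
  neighbour is no better than \<open>p\<close>, it may therefore be applied to \<open>x = p\<close>, that is \<open>X = {}\<close>, and shows
  that \<open>\<mu>\<close> at \<open>p\<close> cannot be positive: the algorithm stops only at minimizers.
\<close>

section \<open>The distance to the set of minimizers\<close>

lemma linf_pos_le_iff: "linf_pos q \<le> a \<longleftrightarrow> 0 \<le> a \<and> (\<forall>i. q $ i \<le> a)"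
  unfolding linf_pos_def by (subst Max_le_iff) auto

lemma linf_neg_le_iff: "linf_neg q \<le> b \<longleftrightarrow> 0 \<le> b \<and> (\<forall>i. - b \<le> q $ i)"
proof -
  have "linf_neg q \<le> b \<longleftrightarrow> (\<forall>i. max 0 (- (q $ i)) \<le> b)"
    unfolding linf_neg_def by (subst Max_le_iff) auto
  then show ?thesis by (auto simp: minus_le_iff)
qed

definition argmin_meets_box ::
  "(int ^ 'n::finite \<Rightarrow> ereal) \<Rightarrow> int ^ 'n \<Rightarrow> nat \<Rightarrow> nat \<Rightarrow> bool" where
  "argmin_meets_box g p a b \<longleftrightarrow>
    (\<exists>r \<in> argmin g. \<forall>i. p $ i - int b \<le> r $ i \<and> r $ i \<le> p $ i + int a)"

lemma mu_le_iff:
  assumes "argmin g \<noteq> {}"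
  shows "mu g p \<le> k \<longleftrightarrow> (\<exists>a b. a + b = k \<and> argmin_meets_box g p a b)"
proof
  let ?D = "\<lambda>d. \<exists>r \<in> argmin g. int d = linf_pos (r - p) + linf_neg (r - p)"
  have nonneg: "0 \<le> linf_pos q" "0 \<le> linf_neg q" for q :: "int ^ 'a"
    using linf_pos_le_iff[of q "linf_pos q"] linf_neg_le_iff[of q "linf_neg q"] by auto
  {
    assume le: "mu g p \<le> k"
    obtain r where "r \<in> argmin g" using assms by auto
    then have "?D (nat (linf_pos (r - p) + linf_neg (r - p)))"
      using nonneg by (intro bexI[of _ r]) auto
    then have "?D (mu g p)" unfolding mu_def by (rule LeastI)
    then obtain r where r: "r \<in> argmin g"
      "int (mu g p) = linf_pos (r - p) + linf_neg (r - p)" by auto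
    let ?a = "nat (linf_pos (r - p))"
    have "?a \<le> k" "linf_pos (r - p) \<le> int ?a" "linf_neg (r - p) \<le> int (k - ?a)"
      using r(2) le nonneg[of "r - p"] by auto
    then have "argmin_meets_box g p ?a (k - ?a)"
      unfolding argmin_meets_box_def linf_pos_le_iff linf_neg_le_iff using r(1)
      by (intro bexI[of _ r]) (auto simp: algebra_simps)
    then show "\<exists>a b. a + b = k \<and> argmin_meets_box g p a b"
      using \<open>?a \<le> k\<close> by (intro exI[of _ ?a] exI[of _ "k - ?a"]) auto
  next
    assume "\<exists>a b. a + b = k \<and> argmin_meets_box g p a b"
    then obtain a b r where ab: "a + b = k" and r: "r \<in> argmin g"
      "\<forall>i. p $ i - int b \<le> r $ i \<and> r $ i \<le> p $ i + int a"
      unfolding argmin_meets_box_def by auto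
    have "linf_pos (r - p) \<le> int a" "linf_neg (r - p) \<le> int b"
      unfolding linf_pos_le_iff linf_neg_le_iff using r(2) by (auto simp: algebra_simps)
    moreover have "?D (nat (linf_pos (r - p) + linf_neg (r - p)))"
      using nonneg r(1) by (intro bexI[of _ r]) auto
    then have "mu g p \<le> nat (linf_pos (r - p) + linf_neg (r - p))"
      unfolding mu_def by (rule Least_le)
    ultimately show "mu g p \<le> k" using ab by linarith
  }
qed

lemma argmin_if_mu_eq_0:
  assumes "argmin g \<noteq> {}" "mu g p = 0"
  shows "p \<in> argmin g"
proof -
  have "argmin_meets_box g p 0 0" using mu_le_iff[OF assms(1), of p 0] assms(2) by auto
  then obtain r where "r \<in> argmin g" "\<forall>i. p $ i \<le> r $ i \<and> r $ i \<le> p $ i"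
    unfolding argmin_meets_box_def by auto
  moreover from this have "r = p" by (simp add: vec_eq_iff order_antisym)
  ultimately show ?thesis by simp
qed

text \<open>Enlarging the box by one in the direction of the move makes it contain the box around the
  neighbour.\<close>

lemma mu_le_Suc_mu_neighbour:
  assumes "argmin g \<noteq> {}" "\<sigma> \<in> {1, -1}"
  shows "mu g p \<le> Suc (mu g (p + \<sigma> *s char_vec X))"
proof -
  let ?x = "p + \<sigma> *s char_vec X"
  obtain a b r where ab: "a + b = mu g ?x" and r: "r \<in> argmin g"
      "\<forall>i. ?x $ i - int b \<le> r $ i \<and> r $ i \<le> ?x $ i + int a"
    using mu_le_iff[OF assms(1), of ?x "mu g ?x"] unfolding argmin_meets_box_def by auto
  have bounds: "?x $ i - int b \<le> r $ i" "r $ i \<le> ?x $ i + int a" for i using r(2) by auto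
  consider "\<sigma> = 1" | "\<sigma> = -1" using assms(2) by auto
  then have "argmin_meets_box g p (Suc a) b \<or> argmin_meets_box g p a (Suc b)"
  proof cases
    case 1
    have "p $ i - int b \<le> r $ i \<and> r $ i \<le> p $ i + int (Suc a)" for i
      using bounds[of i] 1 by (auto simp: char_vec_def split: if_splits)
    then show ?thesis unfolding argmin_meets_box_def using r(1) by blast
  next
    case 2
    have "p $ i - int (Suc b) \<le> r $ i \<and> r $ i \<le> p $ i + int a" for i
      using bounds[of i] 2 by (auto simp: char_vec_def split: if_splits)
    then show ?thesis unfolding argmin_meets_box_def using r(1) by blast
  qed
  then show ?thesis
    using mu_le_iff[OF assms(1), of p "Suc (mu g ?x)"] ab by (metis add_Suc add_Suc_right)
qed

section \<open>Exchanges with a minimizer\<close>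

text \<open>Each of the following facts excludes the strict alternatives of a clause of
  semi-strict quasi-convexity: on the side of the minimizer \<open>r\<close> by minimality, on the side of
  \<open>x\<close> by hypothesis.\<close>

lemma exchange_with_argmin:
  assumes conv: "semistrictly_quasi_Lnat_convex g" and x: "x \<in> eff_dom g" and r: "r \<in> argmin g"
  shows "g x \<le> g ((x - vec (int l)) \<squnion>\<^sub>v r) \<Longrightarrow> x \<sqinter>\<^sub>v (r + vec (int l)) \<in> argmin g"
    and "g x \<le> g (x \<sqinter>\<^sub>v (r + vec (int l))) \<Longrightarrow> (x - vec (int l)) \<squnion>\<^sub>v r \<in> argmin g"
    and "g x \<le> g ((r - vec (int l)) \<squnion>\<^sub>v x) \<Longrightarrow> r \<sqinter>\<^sub>v (x + vec (int l)) \<in> argmin g"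
proof -
  have rd: "r \<in> eff_dom g" and r_le: "\<And>q. g r \<le> g q" using r by (auto simp: argmin_def)
  have transfer: "q \<in> argmin g" if "g r = g q" for q
    using that r by (auto simp: argmin_def eff_dom_def)
  note xr = conv[unfolded semistrictly_quasi_Lnat_convex_def, rule_format, OF x rd, of l]
  note rx = conv[unfolded semistrictly_quasi_Lnat_convex_def, rule_format, OF rd x, of l]
  show "g x \<le> g ((x - vec (int l)) \<squnion>\<^sub>v r) \<Longrightarrow> x \<sqinter>\<^sub>v (r + vec (int l)) \<in> argmin g"
    using xr r_le by (intro transfer) (meson not_le)
  show "g x \<le> g (x \<sqinter>\<^sub>v (r + vec (int l))) \<Longrightarrow> (x - vec (int l)) \<squnion>\<^sub>v r \<in> argmin g"
    using xr r_le by (intro transfer) (meson not_le)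
  show "g x \<le> g ((r - vec (int l)) \<squnion>\<^sub>v x) \<Longrightarrow> r \<sqinter>\<^sub>v (x + vec (int l)) \<in> argmin g"
    using rx r_le by (intro transfer) (meson not_le)
qed

text \<open>Only the comparison with the neighbours of \<open>p\<close> is recorded; \<open>Y = {}\<close> makes \<open>p\<close> one of them.\<close>

definition best_neighbour :: "(int ^ 'n::finite \<Rightarrow> ereal) \<Rightarrow> int ^ 'n \<Rightarrow> int ^ 'n \<Rightarrow> bool" where
  "best_neighbour g p x \<longleftrightarrow> (\<forall>Y. g x \<le> g (p + char_vec Y) \<and> g x \<le> g (p - char_vec Y))"

lemma best_neighbour_in_eff_dom:
  assumes "best_neighbour g p x" "p \<in> eff_dom g"
  shows "x \<in> eff_dom g"
proof -
  have "p + char_vec {} = p" by (simp add: vec_eq_iff char_vec_def)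
  then have "g x \<le> g p" using assms(1) unfolding best_neighbour_def by metis
  then show ?thesis using assms(2) by (auto simp: eff_dom_def)
qed

text \<open>
  When the box extends above \<open>p\<close>, two exchanges suffice. To fit into the smaller box around
  \<open>x = p + e\<^sub>X\<close>, the minimizer must avoid the top level \<open>p + a + 1\<close> outside \<open>X\<close> and the bottom
  level \<open>p - b\<close> inside \<open>X\<close>. Let \<open>A\<close> and \<open>B\<close> be the sets of components at the top and at the
  bottom level. The shift \<open>a\<close> lowers the minimizer by one on \<open>A - X\<close> and takes \<open>x\<close> to
  \<open>p + e\<^bsub>X \<union> A\<^esub>\<close>; then the shift \<open>b\<close> raises it by one on \<open>B \<inter> X\<close> and takes \<open>x\<close> to
  \<open>p + e\<^bsub>X - B\<^esub>\<close>.
\<close>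

lemma argmin_meets_smaller_box_above:
  assumes conv: "semistrictly_quasi_Lnat_convex g" and p: "p \<in> eff_dom g"
    and best: "best_neighbour g p (p + char_vec X)"
    and box: "argmin_meets_box g p (Suc a) b"
  shows "argmin_meets_box g (p + char_vec X) a b"
proof -
  let ?x = "p + char_vec X"
  have x: "?x \<in> eff_dom g" using best_neighbour_in_eff_dom[OF best p] .
  obtain r where r: "r \<in> argmin g"
    and "\<forall>i. p $ i - int b \<le> r $ i \<and> r $ i \<le> p $ i + int (Suc a)"
    using box unfolding argmin_meets_box_def by blast
  then have r_box: "p $ i - int b \<le> r $ i" "r $ i \<le> p $ i + int a + 1" for i
    by (auto simp: algebra_simps)
  let ?A = "{i. r $ i = p $ i + int a + 1}"
  have "(r - vec (int a)) \<squnion>\<^sub>v ?x = p + char_vec (X \<union> ?A)"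
    unfolding vec_eq_iff
  proof
    fix i
    show "((r - vec (int a)) \<squnion>\<^sub>v ?x) $ i = (p + char_vec (X \<union> ?A)) $ i"
      using r_box[of i] by (auto simp: vec_max_def char_vec_def max_def)
  qed
  then have r1: "r \<sqinter>\<^sub>v (?x + vec (int a)) \<in> argmin g" (is "?r1 \<in> _")
    using best unfolding best_neighbour_def by (intro exchange_with_argmin(3)[OF conv x r]) metis
  have r1_box: "p $ i - int b \<le> ?r1 $ i" "?r1 $ i \<le> ?x $ i + int a" for i
    using r_box[of i] by (auto simp: vec_min_def char_vec_def)
  let ?B = "{i. ?r1 $ i = p $ i - int b}"
  have "?x \<sqinter>\<^sub>v (?r1 + vec (int b)) = p + char_vec (X - ?B)"
    unfolding vec_eq_iff
  proof
    fix i
    have "(?x \<sqinter>\<^sub>v (?r1 + vec (int b))) $ i = min (?x $ i) (?r1 $ i + int b)"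
      by (simp add: vec_min_def)
    then show "(?x \<sqinter>\<^sub>v (?r1 + vec (int b))) $ i = (p + char_vec (X - ?B)) $ i"
      using r1_box[of i] by (auto simp: char_vec_def min_def)
  qed
  then have r2: "(?x - vec (int b)) \<squnion>\<^sub>v ?r1 \<in> argmin g" (is "?r2 \<in> _")
    using best unfolding best_neighbour_def by (intro exchange_with_argmin(2)[OF conv x r1]) metis
  have "?x $ i - int b \<le> ?r2 $ i \<and> ?r2 $ i \<le> ?x $ i + int a" for i
    using r1_box[of i] by (auto simp: vec_max_def)
  with r2 show ?thesis unfolding argmin_meets_box_def by blast
qed

text \<open>
  When all of the box lies below \<open>p\<close>, the box is first moved up by one: the shift \<open>1\<close> turns
  \<open>x\<close> into \<open>p - e\<^sub>Y\<close>, with \<open>Y\<close> the complement of \<open>X \<union> {i. r i = p i}\<close>, and \<open>r\<close> into \<open>r + 1\<close> cut off at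
  \<open>x\<close>.
\<close>

lemma argmin_meets_box_raise:
  assumes conv: "semistrictly_quasi_Lnat_convex g" and p: "p \<in> eff_dom g"
    and best: "best_neighbour g p (p + char_vec X)"
    and box: "argmin_meets_box g p 0 (Suc b)"
  shows "argmin_meets_box g p 1 b"
proof -
  let ?x = "p + char_vec X"
  have x: "?x \<in> eff_dom g" using best_neighbour_in_eff_dom[OF best p] .
  obtain r where r: "r \<in> argmin g"
    and "\<forall>i. p $ i - int (Suc b) \<le> r $ i \<and> r $ i \<le> p $ i + int 0"
    using box unfolding argmin_meets_box_def by blast
  then have r_box: "p $ i - int b \<le> r $ i + 1" "r $ i \<le> p $ i" for i
    by (auto simp: algebra_simps)
  let ?Y = "- (X \<union> {i. r $ i = p $ i})"
  have "(?x - vec (int 1)) \<squnion>\<^sub>v r = p - char_vec ?Y"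
    unfolding vec_eq_iff
  proof
    fix i
    show "((?x - vec (int 1)) \<squnion>\<^sub>v r) $ i = (p - char_vec ?Y) $ i"
      using r_box[of i] by (auto simp: vec_max_def char_vec_def max_def)
  qed
  then have r1: "?x \<sqinter>\<^sub>v (r + vec (int 1)) \<in> argmin g" (is "?r1 \<in> _")
    using best unfolding best_neighbour_def by (intro exchange_with_argmin(1)[OF conv x r]) metis
  have "p $ i - int b \<le> ?r1 $ i \<and> ?r1 $ i \<le> p $ i + int 1" for i
    using r_box[of i] by (auto simp: vec_min_def char_vec_def)
  with r1 show ?thesis unfolding argmin_meets_box_def by blast
qed

lemma mu_best_neighbour_up:
  assumes ne: "argmin g \<noteq> {}" and conv: "semistrictly_quasi_Lnat_convex g"
    and p: "p \<in> eff_dom g" and best: "best_neighbour g p (p + char_vec X)"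
    and mu: "mu g p = Suc k"
  shows "mu g (p + char_vec X) \<le> k"
proof -
  obtain a b where ab: "a + b = Suc k" and box: "argmin_meets_box g p a b"
    using mu_le_iff[OF ne, of p "Suc k"] mu by auto
  show ?thesis
  proof (cases a)
    case (Suc a')
    then have "argmin_meets_box g (p + char_vec X) a' b"
      using argmin_meets_smaller_box_above[OF conv p best] box by simp
    then show ?thesis unfolding mu_le_iff[OF ne] using ab Suc by auto
  next
    case 0
    then have "argmin_meets_box g p 1 k"
      using argmin_meets_box_raise[OF conv p best] box ab by simp
    then have "argmin_meets_box g (p + char_vec X) 0 k"
      using argmin_meets_smaller_box_above[OF conv p best, of 0] by simp
    then show ?thesis unfolding mu_le_iff[OF ne] by (intro exI[of _ 0] exI[of _ k]) simp
  qed
qed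

section \<open>Reflection\<close>

lemma argmin_reflect: "argmin (\<lambda>q. g (- q)) = uminus ` argmin g"
proof -
  have "p \<in> argmin (\<lambda>q. g (- q)) \<longleftrightarrow> - p \<in> argmin g" for p
  proof -
    have "(\<forall>q. g (- p) \<le> g (- q)) \<longleftrightarrow> (\<forall>q. g (- p) \<le> g q)"
      by (metis minus_minus)
    then show ?thesis by (simp add: argmin_def eff_dom_def)
  qed
  moreover have "p \<in> uminus ` argmin g \<longleftrightarrow> - p \<in> argmin g" for p
    by (metis image_iff minus_minus)
  ultimately show ?thesis by blast
qed

text \<open>Under \<open>p \<mapsto> - p\<close> the two operations of the definition change places, and so do \<open>p\<close> and
  \<open>q\<close>.\<close>

lemma semistrictly_quasi_Lnat_convex_reflect:
  assumes "semistrictly_quasi_Lnat_convex g"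
  shows "semistrictly_quasi_Lnat_convex (\<lambda>p. g (- p))"
proof -
  have reflect_max: "- ((p - vec l) \<squnion>\<^sub>v q) = (- q) \<sqinter>\<^sub>v (- p + vec l)"
    and reflect_min: "- (p \<sqinter>\<^sub>v (q + vec l)) = (- q - vec l) \<squnion>\<^sub>v (- p)"
    for p q :: "int ^ 'a" and l
    by (auto simp: vec_eq_iff vec_max_def vec_min_def max_def min_def)
  show ?thesis
    unfolding semistrictly_quasi_Lnat_convex_def
  proof (intro ballI allI)
    fix p q l
    assume "p \<in> eff_dom (\<lambda>p. g (- p))" "q \<in> eff_dom (\<lambda>p. g (- p))"
    then have "- q \<in> eff_dom g" "- p \<in> eff_dom g" by (auto simp: eff_dom_def)
    from assms[unfolded semistrictly_quasi_Lnat_convex_def, rule_format, OF this, of l]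
    show "(g (- p) > g (- ((p - vec (int l)) \<squnion>\<^sub>v q)) \<or>
        g (- q) > g (- (p \<sqinter>\<^sub>v (q + vec (int l)))) \<or>
        (g (- p) = g (- ((p - vec (int l)) \<squnion>\<^sub>v q)) \<and> g (- q) = g (- (p \<sqinter>\<^sub>v (q + vec (int l)))))) \<and>
      (g (- q) > g (- ((p - vec (int l)) \<squnion>\<^sub>v q)) \<or>
        g (- p) > g (- (p \<sqinter>\<^sub>v (q + vec (int l)))) \<or>
        (g (- q) = g (- ((p - vec (int l)) \<squnion>\<^sub>v q)) \<and> g (- p) = g (- (p \<sqinter>\<^sub>v (q + vec (int l))))))"
      unfolding reflect_max reflect_min by blast
  qed
qed

lemma argmin_meets_box_reflect:
  "argmin_meets_box (\<lambda>q. g (- q)) (- p) b a \<longleftrightarrow> argmin_meets_box g p a b"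
proof -
  have "(- p) $ i - int a \<le> (- r) $ i \<and> (- r) $ i \<le> (- p) $ i + int b \<longleftrightarrow>
      p $ i - int b \<le> r $ i \<and> r $ i \<le> p $ i + int a" for i and r :: "int ^ 'a"
    by auto
  then show ?thesis unfolding argmin_meets_box_def argmin_reflect bex_simps by simp
qed

lemma mu_reflect:
  assumes "argmin g \<noteq> {}"
  shows "mu (\<lambda>q. g (- q)) (- p) = mu g p"
proof -
  have ne: "argmin (\<lambda>q. g (- q)) \<noteq> {}" using assms by (simp add: argmin_reflect)
  have "mu (\<lambda>q. g (- q)) (- p) \<le> k \<longleftrightarrow> mu g p \<le> k" for k
    unfolding mu_le_iff[OF assms] mu_le_iff[OF ne] using argmin_meets_box_reflect
    by (metis add.commute)
  then show ?thesis by (meson order_antisym order_refl)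
qed

section \<open>Steepest descent\<close>

lemma steepest_iff:
  "steepest g p \<sigma> X \<longleftrightarrow> \<sigma> \<in> {1, -1} \<and> best_neighbour g p (p + \<sigma> *s char_vec X)"
proof -
  have "1 *s char_vec Y = char_vec Y" "(- 1) *s char_vec Y = - char_vec Y" for Y :: "'a set"
    by (simp_all add: vec_eq_iff)
  then have "g x \<le> g (p + char_vec Y) \<and> g x \<le> g (p - char_vec Y) \<longleftrightarrow>
      (\<forall>\<tau> \<in> {1, -1}. g x \<le> g (p + \<tau> *s char_vec Y))" for x Y
    by simp
  then have "best_neighbour g p x \<longleftrightarrow> (\<forall>Y. \<forall>\<tau> \<in> {1, -1}. g x \<le> g (p + \<tau> *s char_vec Y))" for x
    unfolding best_neighbour_def by blast
  then show ?thesis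
    unfolding steepest_def is_arg_min_def split_paired_All prod.case not_ex not_less[symmetric]
    by blast
qed

lemma mu_steepest:
  assumes ne: "argmin g \<noteq> {}" and conv: "semistrictly_quasi_Lnat_convex g"
    and p: "p \<in> eff_dom g" and st: "steepest g p \<sigma> X" and mu: "mu g p = Suc k"
  shows "mu g (p + \<sigma> *s char_vec X) = k"
proof -
  have best: "best_neighbour g p (p + \<sigma> *s char_vec X)" and \<sigma>: "\<sigma> \<in> {1, -1}"
    using st by (auto simp: steepest_iff)
  have "mu g (p + \<sigma> *s char_vec X) \<le> k"
  proof (cases "\<sigma> = 1")
    case True
    then show ?thesis using mu_best_neighbour_up[OF ne conv p _ mu, of X] best by simp
  next
    case False
    let ?h = "\<lambda>q. g (- q)"
    have x: "p + \<sigma> *s char_vec X = - (- p + char_vec X)"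
      using False \<sigma> by (simp add: vec_eq_iff)
    have "argmin ?h \<noteq> {}" using ne by (simp add: argmin_reflect)
    moreover have "- p \<in> eff_dom ?h" using p by (simp add: eff_dom_def)
    moreover have "best_neighbour ?h (- p) (- p + char_vec X)"
      using best unfolding best_neighbour_def x by (simp add: add.commute)
    ultimately have "mu ?h (- p + char_vec X) \<le> k"
      using semistrictly_quasi_Lnat_convex_reflect[OF conv] mu
      by (intro mu_best_neighbour_up) (auto simp: mu_reflect[OF ne])
    then show ?thesis using mu_reflect[OF ne, of "p + \<sigma> *s char_vec X"] unfolding x by simp
  qed
  then show ?thesis using mu_le_Suc_mu_neighbour[OF ne \<sigma>, of p X] mu by simp
qed

text \<open>If the best neighbour is no better than \<open>p\<close>, then \<open>p\<close> itself is a best neighbour, and a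
  positive \<open>\<mu>\<close> would have to decrease without a move.\<close>

lemma argmin_if_steepest_eq:
  assumes ne: "argmin g \<noteq> {}" and conv: "semistrictly_quasi_Lnat_convex g"
    and p: "p \<in> eff_dom g" and st: "steepest g p \<sigma> X" and eq: "g (p + \<sigma> *s char_vec X) = g p"
  shows "p \<in> argmin g"
proof (cases "mu g p")
  case 0
  then show ?thesis using argmin_if_mu_eq_0 ne by blast
next
  case (Suc k)
  have stay: "p + 1 *s char_vec {} = p" by (simp add: vec_eq_iff char_vec_def)
  have "steepest g p 1 {}" using st eq unfolding steepest_iff best_neighbour_def stay by simp
  then have "mu g p = k" using mu_steepest[OF ne conv p _ Suc, of 1 "{}"] unfolding stay by simp
  with Suc show ?thesis by simp
qed

lemma steepest_eq_if_mu_eq_0: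
  assumes ne: "argmin g \<noteq> {}" and mu: "mu g p = 0" and st: "steepest g p \<sigma> X"
  shows "g (p + \<sigma> *s char_vec X) = g p"
proof (rule order_antisym)
  have "p + char_vec {} = p" by (simp add: vec_eq_iff char_vec_def)
  then show "g (p + \<sigma> *s char_vec X) \<le> g p"
    using st unfolding steepest_iff best_neighbour_def by metis
  show "g p \<le> g (p + \<sigma> *s char_vec X)"
    using argmin_if_mu_eq_0[OF ne mu] by (simp add: argmin_def)
qed

lemma mu_eq_0_if_argmin:
  assumes "p \<in> argmin g"
  shows "mu g p = 0"
proof -
  have "argmin_meets_box g p 0 0" using assms unfolding argmin_meets_box_def by auto
  then show ?thesis using mu_le_iff[of g p 0] assms by auto
qed

theorem theorem1p2:
  fixes g :: "int ^ 'n::finite \<Rightarrow> ereal" and p0 :: "int ^ 'n"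
  assumes "\<forall>p. g p \<noteq> - \<infinity>"
    and "semistrictly_quasi_Lnat_convex g"
    and "argmin g \<noteq> {}"
    and "p0 \<in> eff_dom g"
  shows "\<forall>c. sd_execution g p0 c \<longrightarrow>
    (\<exists>r \<in> argmin g. terminates_with c (mu g p0 + 1) r)"
proof (intro allI impI)
  fix c
  assume c: "sd_execution g p0 c"
  have step: "sd_step g (Search p) (c (Suc k))" if "c k = Search p" for k p
    using c that unfolding sd_execution_def by (metis config.simps(5))
  have searching: "\<exists>p \<in> eff_dom g. c j = Search p \<and> mu g p = mu g p0 - j"
    if "j \<le> mu g p0" for j
    using that
  proof (induction j)
    case 0
    then show ?case using c assms(4) by (auto simp: sd_execution_def)
  next
    case (Suc j)
    then obtain p where p: "p \<in> eff_dom g" "c j = Search p" "mu g p = mu g p0 - j" by auto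
    then have mu: "mu g p = Suc (mu g p0 - Suc j)" using Suc.prems by simp
    from step[OF p(2)] show ?case
    proof cases
      case (stop \<sigma> X)
      then have "p \<in> argmin g" using argmin_if_steepest_eq assms(2,3) p(1) by blast
      then show ?thesis using mu mu_eq_0_if_argmin by fastforce
    next
      case (move \<sigma> X)
      then have "p + \<sigma> *s char_vec X \<in> eff_dom g"
        using best_neighbour_in_eff_dom p(1) by (auto simp: steepest_iff)
      then show ?thesis using move mu_steepest[OF assms(3,2) p(1) _ mu] by auto
    qed
  qed
  obtain p where p: "c (mu g p0) = Search p" "mu g p = 0"
    using searching[OF order_refl] by auto
  from step[OF p(1)] have "c (Suc (mu g p0)) = Output p"
    by cases (use steepest_eq_if_mu_eq_0[OF assms(3) p(2)] in auto)
  moreover have "\<exists>q. c j = Search q" if "j < mu g p0 + 1" for j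
    using searching[of j] that by auto
  ultimately have "terminates_with c (mu g p0 + 1) p" by (simp add: terminates_with_def)
  then show "\<exists>r \<in> argmin g. terminates_with c (mu g p0 + 1) r"
    using argmin_if_mu_eq_0[OF assms(3) p(2)] by blast
qed

end
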